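(* Let $m\ge 1$, $N\ge 1$, $M\in\mathfrak{M}_m$ and $\varepsilon>0$. Then there exists $M'\in\mathfrak{ds}_m$ with $d_B(M,M')<\varepsilon$. That is, $\mathfrak{ds}_m$ is dense in $(\mathfrak{M}_m,d_B)$.
   Context: $d$ denotes the Euclidean distance on $\mathbb{R}^N$. $\mathfrak{M}_m$ is the set of subsets $M\subset\mathbb{R}^N$ of cardinality $m$. For $M,M'\in\mathfrak{M}_m$ and a bijection $f:M\to M'$, $\mathrm{sep}\,f:=\max\{d(x,f(x)):x\in M\}$, and $d_B(M,M'):=\min\{\mathrm{sep}\,f: f:M\to M' \text{ a bijection}\}$. For $M\in\mathfrak{M}_m$, $DM_+:=\{d(x,y):x,y\in M\}\setminus\{0\}$. $M$ is distance separated if $|DM_+|=m(m-1)/2$, i.e. all distances between distinct unordered pairs of points are pairwise different. $\mathfrak{ds}_m\subset\mathfrak{M}_m$ is the set of distance separated spaces. *)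

theory Defs
  imports "HOL-Analysis.Analysis"
begin

definition spaces :: "nat \<Rightarrow> 'a::metric_space set set" where
  "spaces m = {M. finite M \<and> card M = m}"

definition sep :: "'a::metric_space set \<Rightarrow> ('a \<Rightarrow> 'a) \<Rightarrow> real" where
  "sep M f = Max ((\<lambda>x. dist x (f x)) ` M)"

text \<open>The distance is only meant for nonempty finite sets of the same cardinality. On all
  other arguments it gets the value 0, because the locale \<^locale>\<open>Metric_space\<close> asks for
  nonnegativity and symmetry outside of the carrier as well. The set below is finite although
  there are infinitely many functions \<open>f\<close> (total functions, arbitrary outside of \<open>M\<close>), since
  \<open>sep M f\<close> is one of the finitely many distances between points of \<open>M\<close> and \<open>M'\<close>.\<close>

definition d_B :: "'a::metric_space set \<Rightarrow> 'a set \<Rightarrow> real" where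
  "d_B M M' =
    (if finite M \<and> finite M' \<and> card M = card M' \<and> M \<noteq> {}
     then Min {sep M f | f. bij_betw f M M'} else 0)"

definition pos_dists :: "'a::metric_space set \<Rightarrow> real set" where
  "pos_dists M = {dist x y | x y. x \<in> M \<and> y \<in> M} - {0}"

definition distance_separated :: "'a::metric_space set \<Rightarrow> bool" where
  "distance_separated M \<longleftrightarrow> card (pos_dists M) = card M * (card M - 1) div 2"

definition ds_spaces :: "nat \<Rightarrow> 'a::metric_space set set" where
  "ds_spaces m = {M \<in> spaces m. distance_separated M}"

lemma sep_in_dists:
  assumes "finite M" "M \<noteq> {}" "bij_betw f M M'"
  shows "sep M f \<in> (\<lambda>(x, y). dist x y) ` (M \<times> M')"
proof -
  have "sep M f \<in> (\<lambda>x. dist x (f x)) ` M"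
    unfolding sep_def using assms by (intro Max_in) auto
  then show ?thesis using assms(3) by (force simp: bij_betw_def)
qed

lemma finite_seps:
  assumes "finite M" "finite M'" "M \<noteq> {}"
  shows "finite {sep M f | f. bij_betw f M M'}"
proof (rule finite_subset)
  show "{sep M f | f. bij_betw f M M'} \<subseteq> (\<lambda>(x, y). dist x y) ` (M \<times> M')"
    using sep_in_dists[OF assms(1,3)] by blast
qed (use assms in auto)

lemma d_B_attained:
  assumes "finite M" "finite M'" "card M = card M'" "M \<noteq> {}"
  obtains f where "bij_betw f M M'" "d_B M M' = sep M f"
proof -
  obtain g where "bij_betw g M M'"
    using finite_same_card_bij assms by blast
  then have "Min {sep M f | f. bij_betw f M M'} \<in> {sep M f | f. bij_betw f M M'}"
    using finite_seps assms by (intro Min_in) auto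
  then show ?thesis using that assms unfolding d_B_def by auto
qed

lemma d_B_le:
  assumes "finite M" "finite M'" "M \<noteq> {}" "bij_betw f M M'"
  shows "d_B M M' \<le> sep M f"
proof -
  have "Min {sep M f | f. bij_betw f M M'} \<le> sep M f"
    using finite_seps assms by (intro Min_le) auto
  then show ?thesis
    using assms bij_betw_same_card[OF assms(4)] by (simp add: d_B_def)
qed

lemma dist_le_sep: "finite M \<Longrightarrow> x \<in> M \<Longrightarrow> dist x (f x) \<le> sep M f"
  unfolding sep_def by (intro Max_ge) auto

lemma sep_le: "finite M \<Longrightarrow> M \<noteq> {} \<Longrightarrow> (\<And>x. x \<in> M \<Longrightarrow> dist x (f x) \<le> c) \<Longrightarrow> sep M f \<le> c"
  unfolding sep_def by (subst Max_le_iff) auto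

lemma d_B_nonneg: "0 \<le> d_B M M'"
proof (cases "finite M \<and> finite M' \<and> card M = card M' \<and> M \<noteq> {}")
  case True
  then obtain f where f: "bij_betw f M M'" "d_B M M' = sep M f"
    using d_B_attained by blast
  obtain x where "x \<in> M" using True by blast
  then show ?thesis
    using f True dist_le_sep[of M x f] zero_le_dist[of x "f x"] by linarith
qed (auto simp: d_B_def)

lemma d_B_commute_le:
  assumes "finite M" "finite M'" "card M = card M'" "M \<noteq> {}"
  shows "d_B M' M \<le> d_B M M'"
proof -
  obtain f where f: "bij_betw f M M'" "d_B M M' = sep M f"
    using d_B_attained assms by blast
  let ?g = "inv_into M f"
  have g: "bij_betw ?g M' M" using f bij_betw_inv_into by blast
  have ne: "M' \<noteq> {}" using assms by auto
  have "sep M' ?g \<le> sep M f"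
  proof (rule sep_le[OF assms(2) ne])
    fix y assume "y \<in> M'"
    then have "?g y \<in> M" "f (?g y) = y"
      using g f bij_betwE bij_betw_inv_into_right by fastforce+
    then show "dist y (?g y) \<le> sep M f"
      using dist_le_sep[OF assms(1), of "?g y" f] by (simp add: dist_commute)
  qed
  then show ?thesis using d_B_le[OF assms(2,1) ne g] f by linarith
qed

lemma Metric_space_d_B: "Metric_space (spaces m) d_B"
proof
  fix M M' :: "'a set"
  show "0 \<le> d_B M M'" by (rule d_B_nonneg)
  show "d_B M M' = d_B M' M"
  proof (cases "finite M \<and> finite M' \<and> card M = card M' \<and> M \<noteq> {}")
    case True
    moreover from True have "M' \<noteq> {}" by auto
    ultimately show ?thesis by (metis d_B_commute_le order_antisym)
  next
    case False
    then have "\<not> (finite M' \<and> finite M \<and> card M' = card M \<and> M' \<noteq> {})" by auto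
    with False show ?thesis unfolding d_B_def by (simp only: if_False)
  qed
next
  fix M M' :: "'a set"
  assume "M \<in> spaces m" "M' \<in> spaces m"
  then have fin: "finite M" "finite M'" "card M = card M'" by (auto simp: spaces_def)
  show "d_B M M' = 0 \<longleftrightarrow> M = M'"
  proof (cases "M = {}")
    case True
    then show ?thesis using fin by (auto simp: d_B_def)
  next
    case ne: False
    show ?thesis
    proof
      assume 0: "d_B M M' = 0"
      obtain f where f: "bij_betw f M M'" "d_B M M' = sep M f"
        using d_B_attained fin ne by blast
      have "f x = x" if "x \<in> M" for x
        using dist_le_sep[OF fin(1) that, of f] f 0 by simp
      then have "f ` M = M" by simp
      then show "M = M'" using f by (simp add: bij_betw_def)
    next
      assume "M = M'"
      moreover have "sep M id \<le> 0" by (rule sep_le) (use fin ne in auto)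
      ultimately show "d_B M M' = 0"
        using d_B_le[of M M' id] fin ne d_B_nonneg[of M M'] by simp
    qed
  qed
next
  fix L M K :: "'a set"
  assume "L \<in> spaces m" "M \<in> spaces m" "K \<in> spaces m"
  then have fin: "finite L" "finite M" "finite K" "card L = card M" "card M = card K"
    by (auto simp: spaces_def)
  show "d_B L K \<le> d_B L M + d_B M K"
  proof (cases "L = {}")
    case True
    then show ?thesis using d_B_nonneg[of L M] d_B_nonneg[of M K] by (simp add: d_B_def)
  next
    case ne: False
    then have neM: "M \<noteq> {}" using fin by auto
    obtain f where f: "bij_betw f L M" "d_B L M = sep L f"
      using d_B_attained fin ne by blast
    obtain g where g: "bij_betw g M K" "d_B M K = sep M g"
      using d_B_attained fin neM by blast
    have "sep L (g \<circ> f) \<le> sep L f + sep M g"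
    proof (rule sep_le[OF fin(1) ne])
      fix x assume x: "x \<in> L"
      then have "f x \<in> M" using f bij_betwE by blast
      then show "dist x ((g \<circ> f) x) \<le> sep L f + sep M g"
        using dist_le_sep[OF fin(1) x, of f] dist_le_sep[OF fin(2), of "f x" g]
          dist_triangle[of x "g (f x)" "f x"] by simp
    qed
    then show ?thesis
      using d_B_le[OF fin(1,3) ne bij_betw_trans[OF f(1) g(1)]] f g by linarith
  qed
qed

end

theory Submission
  imports Defs
begin

text \<open>
  Perturb the points one at a time. Given a distance separated perturbation of all other points,
  the bad positions for the next point lie on finitely many spheres (around an old point, with
  radius 0 or an old distance) and finitely many hyperplanes (bisectors of two old points).
  These form a null set, which cannot cover a ball.
\<close>

text \<open>After squaring both distances the term \<open>y \<bullet> y\<close> cancels. What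
  remains is one linear equation with normal vector \<open>q - p\<close>, which is nonzero, so the
  set is a hyperplane.\<close>

lemma negligible_bisector:
  fixes p q :: "'a::euclidean_space"
  assumes "p \<noteq> q"
  shows "negligible {y. dist y p = dist y q}"
proof -
  have "{y. dist y p = dist y q} = {y. (q - p) \<bullet> y = (q \<bullet> q - p \<bullet> p) / 2}"
    by (auto simp: dist_norm norm_eq algebra_simps inner_commute)
  moreover have "q - p \<noteq> 0"
    using assms by simp
  ultimately show ?thesis
    by (simp only: negligible_hyperplane simp_thms)
qed

lemma finite_pos_dists:
  assumes "finite M"
  shows "finite (pos_dists M)"
proof -
  have "pos_dists M \<subseteq> (\<lambda>(x, y). dist x y) ` (M \<times> M)"
    by (auto simp: pos_dists_def)
  then show ?thesis
    using assms finite_subset by blast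
qed

lemma distance_separated_insert:
  assumes fin: "finite M" and sep: "distance_separated M" and y: "y \<notin> M"
    and inj: "inj_on (dist y) M" and disj: "dist y ` M \<inter> pos_dists M = {}"
  shows "distance_separated (insert y M)"
proof -
  \<comment> \<open>Since \<open>y \<notin> M\<close>, no distance from \<open>y\<close> to
    \<open>M\<close> is lost when 0 is removed.\<close>
  have "pos_dists (insert y M) = dist y ` M \<union> pos_dists M"
    using y by (fastforce simp: pos_dists_def dist_commute)
  then have "card (pos_dists (insert y M)) = card M + card (pos_dists M)"
    using fin finite_pos_dists[OF fin] disj by (simp add: card_Un_disjoint card_image inj)
  also have "\<dots> = card M + card M * (card M - 1) div 2"
    using sep by (simp add: distance_separated_def)
  also have "\<dots> = Suc (card M) * card M div 2"
    \<comment> \<open>The case split handles the truncated subtraction \<open>card M - 1\<close> at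
      0.\<close>
    by (cases "card M") auto
  finally show ?thesis
    using fin y by (simp add: distance_separated_def)
qed

lemma distance_separated_extension:
  fixes x :: "'a::euclidean_space"
  assumes fin: "finite M" and sep: "distance_separated M" and "e > 0"
  obtains y where "dist x y < e" "y \<notin> M" "distance_separated (insert y M)"
proof -
  \<comment> \<open>Avoiding radius 0 gives \<open>y \<notin> M\<close>, avoiding the other radii
    keeps new distances apart from old ones, and avoiding the bisectors keeps the new distances
    apart from each other.\<close>
  define B where "B = (\<Union>p\<in>M. \<Union>r\<in>insert 0 (pos_dists M). sphere p r) \<union>
    (\<Union>p\<in>M. \<Union>q\<in>M - {p}. {y. dist y p = dist y q})"
  have "negligible B"
    unfolding B_def using fin finite_pos_dists[OF fin]
    by (auto intro!: negligible_Un negligible_Union negligible_sphere negligible_bisector)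
  then have "\<not> ball x e \<subseteq> B"
    using open_not_negligible[of "ball x e"] negligible_subset \<open>e > 0\<close> by auto
  then obtain y where y: "dist x y < e" "y \<notin> B"
    unfolding subset_iff mem_ball by blast
  have "y \<notin> M"
    using y by (auto simp: B_def)
  moreover have "inj_on (dist y) M"
    using y by (auto simp: B_def inj_on_def)
  moreover have "dist y ` M \<inter> pos_dists M = {}"
    using y by (auto simp: B_def dist_commute)
  ultimately show ?thesis
    using that y distance_separated_insert[OF fin sep] by blast
qed

text \<open>The result is a map rather than a set because \<open>f\<close> itself is the bijection
  that later bounds \<open>d_B\<close>.\<close>

lemma distance_separated_perturbation:
  fixes M :: "'a::euclidean_space set"
  assumes "finite M" "e > 0"
  shows "\<exists>f. inj_on f M \<and> distance_separated (f ` M) \<and> (\<forall>x\<in>M. dist x (f x) < e)"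
  using assms(1)
proof induction
  case empty
  show ?case by (simp add: distance_separated_def pos_dists_def)
next
  case (insert x M)
  then obtain f where f: "inj_on f M" "distance_separated (f ` M)" "\<forall>z\<in>M. dist z (f z) < e"
    by blast
  obtain y where y: "dist x y < e" "y \<notin> f ` M" "distance_separated (insert y (f ` M))"
    using distance_separated_extension[of "f ` M" e x] f insert.hyps assms(2) by blast
  have "(f(x := y)) ` insert x M = insert y (f ` M)"
    using insert.hyps by auto
  moreover have "inj_on (f(x := y)) (insert x M)"
    using insert.hyps f(1) y(2) by (auto simp: inj_on_def)
  moreover have "\<forall>z\<in>insert x M. dist z ((f(x := y)) z) < e"
    using f(3) y(1) by simp
  ultimately show ?case
    using y(3) by metis
qed

lemma ds_spaces_dense:
  fixes M :: "'a::euclidean_space set"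
  assumes M: "M \<in> spaces m" and "e > 0"
  shows "\<exists>M'\<in>ds_spaces m. d_B M M' < e"
proof -
  have fin: "finite M" using M by (simp add: spaces_def)
  \<comment> \<open>\<open>sep_le\<close> yields only a weak inequality; halving \<open>e\<close>
    makes the final bound strict.\<close>
  obtain f where f: "inj_on f M" "distance_separated (f ` M)" "\<forall>x\<in>M. dist x (f x) < e / 2"
    using distance_separated_perturbation[OF fin, of "e / 2"] \<open>e > 0\<close> by auto
  have "d_B M (f ` M) < e"
  proof (cases "M = {}")
    \<comment> \<open>This is the case \<open>m = 0\<close>, where \<open>d_B\<close> takes its
      default value 0.\<close>
    case True
    then show ?thesis using \<open>e > 0\<close> by (simp add: d_B_def)
  next
    case False
    have "d_B M (f ` M) \<le> sep M f"
      using fin False f(1) by (intro d_B_le) (auto simp: bij_betw_def)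
    also have "\<dots> \<le> e / 2"
      using fin False f(3) by (intro sep_le) (auto intro: less_imp_le)
    finally show ?thesis using \<open>e > 0\<close> by simp
  qed
  moreover have "f ` M \<in> ds_spaces m"
    using M f by (simp add: ds_spaces_def spaces_def card_image)
  ultimately show ?thesis by blast
qed

theorem theorem3p8:
  fixes m :: nat
  assumes "m \<ge> 1"
  shows "(\<forall>M \<in> (spaces m :: (real ^ 'n) set set). \<forall>\<epsilon>>0. \<exists>M' \<in> ds_spaces m. d_B M M' < \<epsilon>) \<and>
    Metric_space.mtopology (spaces m :: (real ^ 'n) set set) d_B closure_of ds_spaces m = spaces m"
proof
  show dense: "\<forall>M \<in> (spaces m :: (real ^ 'n) set set). \<forall>\<epsilon>>0. \<exists>M' \<in> ds_spaces m. d_B M M' < \<epsilon>"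
    using ds_spaces_dense by blast
  interpret Metric_space "spaces m :: (real ^ 'n) set set" d_B
    by (rule Metric_space_d_B)
  show "mtopology closure_of ds_spaces m = spaces m"
    \<comment> \<open>A point of the carrier lies in the closure iff each ball around it meets the
      set. Balls contain only members of \<open>spaces m\<close>, hence the unfolding of
      \<open>ds_spaces_def\<close>.\<close>
    using dense by (fastforce simp: metric_closure_of in_mball ds_spaces_def)
qed

end
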